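(* Let $(\Omega,\mathcal{F},P)$ be a probability space, $(\mathcal{F}^k)_{k\ge1}$ a decreasing sequence of sub-sigma-fields of $\mathcal{F}$, and $X$ an integrable random variable with values in a separable Hilbert space (with norm $|\cdot|$). Let $(a_j)_{j\ge1}$ be real constants with $\sum_{j\ge1}|a_j|=\infty$. Put $s_0=0$, $s_k=\sum_{i=1}^ka_i$, $s_k^*=\max_{1\le j\le k}|s_j|$ and $$b_k=\max\big(k^{-1}(s_{4k}^* )^2,\ s_k^2-s_{k-1}^2\big),\qquad k\ge1.$$ If $$\sum_{k\ge1}b_k\,E|E^kX|^2<\infty,$$ then the sequence $\big(\sum_{i=1}^na_iE^iX\big)_{n\ge1}$ converges in $L_2$ and almost surely.
   Context: $E^jX=E(X\mid\mathcal{F}^j)$ denotes conditional expectation. Expectations $E|E^kX|^2$ are taken in $[0,\infty]$, with $0\cdot\infty=0$. Convergence in $L_2$ means convergence in the norm $\|Y\|_2=(E|Y|^2)^{1/2}$. *)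

theory Defs
  imports "HOL-Probability.Probability"
begin

text \<open>
  The library's \<open>real_cond_exp\<close> covers real-valued functions only.  For vector-valued
  \<open>f\<close> we say that \<open>g\<close> is a version of the conditional expectation of \<open>f\<close> given the
  sub-sigma-field \<open>F\<close>.  Integrability of \<open>f\<close> and \<open>g\<close> is required explicitly because the
  Bochner integral of a non-integrable function is \<open>0\<close>.
\<close>

definition has_cond_exp ::
  "'a measure \<Rightarrow> 'a measure \<Rightarrow> ('a \<Rightarrow> 'b::{banach, second_countable_topology}) \<Rightarrow> ('a \<Rightarrow> 'b) \<Rightarrow> bool"
  where "has_cond_exp M F f g \<longleftrightarrow>
    integrable M f \<and> integrable M g \<and> g \<in> borel_measurable F \<and>
    (\<forall>A\<in>sets F. (LINT x:A|M. g x) = (LINT x:A|M. f x))"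

definition L2_space :: "'a measure \<Rightarrow> ('a \<Rightarrow> 'b::{banach, second_countable_topology}) set"
  where "L2_space M = {f \<in> borel_measurable M. integrable M (\<lambda>x. (norm (f x))\<^sup>2)}"

text \<open>Meaningful on \<^const>\<open>L2_space\<close> only; elsewhere the integral takes the default value \<open>0\<close>.\<close>

definition L2_norm :: "'a measure \<Rightarrow> ('a \<Rightarrow> 'b::{banach, second_countable_topology}) \<Rightarrow> real"
  where "L2_norm M f = sqrt (LINT x|M. (norm (f x))\<^sup>2)"

definition tendsto_L2 ::
  "'a measure \<Rightarrow> (nat \<Rightarrow> 'a \<Rightarrow> 'b::{banach, second_countable_topology}) \<Rightarrow> ('a \<Rightarrow> 'b) \<Rightarrow> bool"
  where "tendsto_L2 M f g \<longleftrightarrow>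
    (\<forall>n. f n \<in> L2_space M) \<and> g \<in> L2_space M \<and>
    (\<lambda>n. L2_norm M (\<lambda>x. f n x - g x)) \<longlonglongrightarrow> 0"

text \<open>Sequences are indexed from \<open>1\<close>; the value at index \<open>0\<close> of \<open>a\<close> is never used.\<close>

definition psum :: "(nat \<Rightarrow> real) \<Rightarrow> nat \<Rightarrow> real"
  where "psum a k = (\<Sum>i=1..k. a i)"

definition psum_max :: "(nat \<Rightarrow> real) \<Rightarrow> nat \<Rightarrow> real"
  where "psum_max a k = Max ((\<lambda>j. \<bar>psum a j\<bar>) ` {1..k})"

definition weight :: "(nat \<Rightarrow> real) \<Rightarrow> nat \<Rightarrow> real"
  where "weight a k =
    max ((psum_max a (4 * k))\<^sup>2 / real k) ((psum a k)\<^sup>2 - (psum a (k - 1))\<^sup>2)"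

end

theory Submission
  imports Defs
begin

text \<open>
  With \<open>D i = Y i - Y (i + 1)\<close>, summation by parts gives
  \<open>(\<Sum>i=1..n. a i Y i) = s n Y n + (\<Sum>i<n. s i D i)\<close>.  The differences \<open>D i\<close> are orthogonal with
  \<open>E|D i|^2 = E|Y i|^2 - E|Y (i + 1)|^2\<close>, so a second summation by parts bounds
  \<open>\<Sum>i. (s i)^2 E|D i|^2\<close> by \<open>\<Sum>k. ((s k)^2 - (s (k - 1))^2) E|Y k|^2\<close>; the tails of \<open>\<Sum>i. s i D i\<close> form a
  reverse martingale, and Doob's inequality yields almost sure convergence.  The term \<open>s n Y n\<close> is
  handled over dyadic blocks: Doob's inequality for the reverse martingale \<open>Y\<close>, Borel-Cantelli and
  the weights \<open>s*(4k)^2 / k\<close> show that it tends to \<open>0\<close>.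
\<close>

section \<open>Square-integrable vector-valued functions\<close>

lemma L2_spaceI:
  "f \<in> borel_measurable M \<Longrightarrow> integrable M (\<lambda>x. (norm (f x))\<^sup>2) \<Longrightarrow> f \<in> L2_space M"
  by (simp add: L2_space_def)

lemma L2_space_measurable [measurable_dest]: "f \<in> L2_space M \<Longrightarrow> f \<in> borel_measurable M"
  by (simp add: L2_space_def)

lemma L2_space_integrable: "f \<in> L2_space M \<Longrightarrow> integrable M (\<lambda>x. (norm (f x))\<^sup>2)"
  by (simp add: L2_space_def)

lemma norm_add_sq_le: "(norm (u + v))\<^sup>2 \<le> 2 * (norm u)\<^sup>2 + 2 * (norm (v :: 'b :: real_normed_vector))\<^sup>2"
proof -
  have "(norm (u + v))\<^sup>2 \<le> (norm u + norm v)\<^sup>2"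
    by (intro power_mono norm_triangle_ineq) auto
  also have "\<dots> \<le> 2 * (norm u)\<^sup>2 + 2 * (norm v)\<^sup>2"
    using sum_squares_bound[of "norm u" "norm v"] by (simp add: power2_sum)
  finally show ?thesis .
qed

lemma L2_space_add:
  assumes f: "f \<in> L2_space M" and g: "g \<in> L2_space M"
  shows "(\<lambda>x. f x + g x) \<in> L2_space M"
proof (rule L2_spaceI)
  note [measurable] = L2_space_measurable[OF f] L2_space_measurable[OF g]
  show "(\<lambda>x. f x + g x) \<in> borel_measurable M" by measurable
  show "integrable M (\<lambda>x. (norm (f x + g x))\<^sup>2)"
    by (rule Bochner_Integration.integrable_bound[of M "\<lambda>x. 2 * (norm (f x))\<^sup>2 + 2 * (norm (g x))\<^sup>2"])
      (use L2_space_integrable[OF f] L2_space_integrable[OF g] in \<open>auto intro!: AE_I2 norm_add_sq_le\<close>)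
qed

lemma L2_space_scaleR:
  assumes f: "f \<in> L2_space M"
  shows "(\<lambda>x. c *\<^sub>R f x) \<in> L2_space M"
  using assms by (auto simp: L2_space_def power_mult_distrib)

lemma L2_space_diff:
  assumes f: "f \<in> L2_space M" and g: "g \<in> L2_space M"
  shows "(\<lambda>x. f x - g x) \<in> L2_space M"
  using L2_space_add[OF f L2_space_scaleR[OF g, of "-1"]] by simp

lemma L2_space_sum:
  "(\<And>i. i \<in> I \<Longrightarrow> f i \<in> L2_space M) \<Longrightarrow> (\<lambda>x. \<Sum>i\<in>I. f i x) \<in> L2_space M"
proof (induction I rule: infinite_finite_induct)
  case (insert i I)
  then show ?case using L2_space_add[of "f i" M "\<lambda>x. \<Sum>i\<in>I. f i x"] by simp
qed (simp_all add: L2_space_def)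

lemma L2_space_indicator:
  assumes f: "f \<in> L2_space M" and [measurable]: "A \<in> sets M"
  shows "(\<lambda>x. indicator A x *\<^sub>R f x) \<in> L2_space M"
proof (rule L2_spaceI)
  note [measurable] = L2_space_measurable[OF f]
  show "(\<lambda>x. indicator A x *\<^sub>R f x) \<in> borel_measurable M" by measurable
  show "integrable M (\<lambda>x. (norm (indicator A x *\<^sub>R f x))\<^sup>2)"
    by (rule Bochner_Integration.integrable_bound[OF L2_space_integrable[OF f]])
      (auto simp: indicator_def)
qed

lemma L2_space_integrable_norm_mult:
  assumes f: "f \<in> L2_space M" and g: "g \<in> L2_space M"
  shows "integrable M (\<lambda>x. norm (f x) * norm (g x))"
proof -
  note [measurable] = L2_space_measurable[OF f] L2_space_measurable[OF g]
  have le: "norm (f x) * norm (g x) \<le> (norm (f x))\<^sup>2 + (norm (g x))\<^sup>2" for x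
  proof -
    have "0 \<le> norm (f x) * norm (g x)" by simp
    with sum_squares_bound[of "norm (f x)" "norm (g x)"] show ?thesis by linarith
  qed
  show ?thesis
    by (rule Bochner_Integration.integrable_bound[of M "\<lambda>x. (norm (f x))\<^sup>2 + (norm (g x))\<^sup>2"])
      (use L2_space_integrable[OF f] L2_space_integrable[OF g] le in auto)
qed

lemma L2_space_integrable_inner:
  fixes f g :: "'a \<Rightarrow> 'h::{real_inner, banach, second_countable_topology}"
  assumes f: "f \<in> L2_space M" and g: "g \<in> L2_space M"
  shows "integrable M (\<lambda>x. f x \<bullet> g x)"
proof -
  note [measurable] = L2_space_measurable[OF f] L2_space_measurable[OF g]
  show ?thesis
    by (rule Bochner_Integration.integrable_bound[OF L2_space_integrable_norm_mult[OF f g]])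
      (auto intro!: AE_I2 Cauchy_Schwarz_ineq2)
qed

lemma (in finite_measure) L2_space_imp_integrable:
  assumes f: "f \<in> L2_space M"
  shows "integrable M f"
proof -
  note [measurable] = L2_space_measurable[OF f]
  have le: "norm (f x) \<le> 1 + (norm (f x))\<^sup>2" for x
  proof -
    have "2 * norm (f x) \<le> 1 + (norm (f x))\<^sup>2"
      using sum_squares_bound[of 1 "norm (f x)"] by simp
    then show ?thesis using norm_ge_zero[of "f x"] by linarith
  qed
  show ?thesis
    by (rule Bochner_Integration.integrable_bound[of M "\<lambda>x. 1 + (norm (f x))\<^sup>2"])
      (use L2_space_integrable[OF f] le in auto)
qed

lemma integral_norm_sq_add:
  fixes f g :: "'a \<Rightarrow> 'h::{real_inner, banach, second_countable_topology}"
  assumes f: "f \<in> L2_space M" and g: "g \<in> L2_space M"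
  shows "(LINT x|M. (norm (f x + g x))\<^sup>2) =
    (LINT x|M. (norm (f x))\<^sup>2) + 2 * (LINT x|M. f x \<bullet> g x) + (LINT x|M. (norm (g x))\<^sup>2)"
proof -
  have "(norm (f x + g x))\<^sup>2 = (norm (f x))\<^sup>2 + 2 * (f x \<bullet> g x) + (norm (g x))\<^sup>2" for x
    by (simp add: power2_norm_eq_inner algebra_simps inner_commute)
  then show ?thesis
    using L2_space_integrable[OF f] L2_space_integrable[OF g] L2_space_integrable_inner[OF f g]
    by simp
qed

section \<open>Orthogonality and Doob's inequality for reverse martingales\<close>

text \<open>A simple \<open>h\<close> is a finite sum of vectors \<open>v\<close> times indicators
  of sets in \<open>G\<close>; each constant \<open>v\<close> moves out of the integral of
  \<open>v \<bullet> (indicator (A v) x *\<^sub>R g x)\<close>, leaving a set integral of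
  \<open>g\<close> that vanishes.\<close>

lemma integral_inner_simple_function:
  fixes g h :: "'a \<Rightarrow> 'h::{real_inner, banach, second_countable_topology}"
  assumes sub: "subalgebra M G" and g: "integrable M g"
    and zero: "\<And>A. A \<in> sets G \<Longrightarrow> (LINT x:A|M. g x) = 0"
    and h: "simple_function G h"
  shows "(LINT x|M. h x \<bullet> g x) = 0"
proof -
  define A where "A v = h -` {v} \<inter> space G" for v
  have sp: "space G = space M" using sub by (simp add: subalgebra_def)
  have AG: "A v \<in> sets G" for v
    using h by (simp add: A_def simple_functionD)
  then have AM [measurable]: "A v \<in> sets M" for v
    using sub by (auto simp: subalgebra_def)
  have fin: "finite (h ` space M)" using h sp by (auto dest: simple_functionD(1))
  have int: "integrable M (\<lambda>x. indicator (A v) x *\<^sub>R g x)" for v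
    using g by (rule integrable_mult_indicator[OF AM])
  have "h x \<bullet> g x = (\<Sum>v\<in>h ` space M. v \<bullet> (indicator (A v) x *\<^sub>R g x))" if x: "x \<in> space M" for x
  proof -
    have "(\<Sum>v\<in>h ` space M. v \<bullet> (indicator (A v) x *\<^sub>R g x))
        = (\<Sum>v\<in>h ` space M. if v = h x then v \<bullet> g x else 0)"
      using x sp by (intro sum.cong) (auto simp: A_def indicator_def)
    also have "\<dots> = h x \<bullet> g x" using fin x by (simp add: sum.delta')
    finally show ?thesis by simp
  qed
  then have "(LINT x|M. h x \<bullet> g x) = (LINT x|M. (\<Sum>v\<in>h ` space M. v \<bullet> (indicator (A v) x *\<^sub>R g x)))"
    by (intro Bochner_Integration.integral_cong) auto
  also have "\<dots> = (\<Sum>v\<in>h ` space M. v \<bullet> (LINT x|M. indicator (A v) x *\<^sub>R g x))"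
    by (simp only: Bochner_Integration.integral_sum integrable_inner_right int integral_inner_right)
  also have "\<dots> = 0"
    using zero[OF AG] by (simp add: set_lebesgue_integral_def)
  finally show ?thesis .
qed

text \<open>This plays the part of taking out what is known: E(g|G) = 0 makes \<open>g\<close>
  orthogonal to everything \<open>G\<close>-measurable. Simple functions with norm at most
  \<open>2 * norm (h x)\<close> approximate \<open>h\<close>, and dominated convergence applies
  because |h||g| is integrable.\<close>

lemma (in finite_measure) integral_inner_eq_0:
  fixes g h :: "'a \<Rightarrow> 'h::{real_inner, banach, second_countable_topology}"
  assumes sub: "subalgebra M G" and g: "g \<in> L2_space M"
    and zero: "\<And>A. A \<in> sets G \<Longrightarrow> (LINT x:A|M. g x) = 0"
    and h: "h \<in> L2_space M" "h \<in> borel_measurable G"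
  shows "(LINT x|M. h x \<bullet> g x) = 0"
proof -
  have sp: "space G = space M" using sub by (simp add: subalgebra_def)
  note [measurable] = L2_space_measurable[OF g] L2_space_measurable[OF h(1)]
  obtain S where S: "\<And>i. simple_function G (S i)"
    "\<And>x. x \<in> space G \<Longrightarrow> (\<lambda>i. S i x) \<longlonglongrightarrow> h x"
    "\<And>i x. x \<in> space G \<Longrightarrow> dist (S i x) 0 \<le> 2 * dist (h x) 0"
    using borel_measurable_implies_sequence_metric[OF h(2), of 0] by metis
  have SM [measurable]: "S i \<in> borel_measurable M" for i
    using borel_measurable_simple_function[OF S(1)] measurable_from_subalg[OF sub] by blast
  have "(\<lambda>i. LINT x|M. S i x \<bullet> g x) \<longlonglongrightarrow> (LINT x|M. h x \<bullet> g x)"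
  proof (rule integral_dominated_convergence[where w = "\<lambda>x. 2 * (norm (h x) * norm (g x))"])
    show "integrable M (\<lambda>x. 2 * (norm (h x) * norm (g x)))"
      using L2_space_integrable_norm_mult[OF h(1) g] by simp
    show "AE x in M. (\<lambda>i. S i x \<bullet> g x) \<longlonglongrightarrow> h x \<bullet> g x"
      using S(2) sp by (auto intro!: AE_I2 tendsto_inner)
    show "AE x in M. norm (S i x \<bullet> g x) \<le> 2 * (norm (h x) * norm (g x))" for i
    proof (rule AE_I2)
      fix x assume "x \<in> space M"
      then have "norm (S i x) \<le> 2 * norm (h x)" using S(3)[of x i] sp by simp
      then have "norm (S i x) * norm (g x) \<le> 2 * norm (h x) * norm (g x)"
        by (rule mult_right_mono) simp
      with Cauchy_Schwarz_ineq2[of "S i x" "g x"]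
      show "norm (S i x \<bullet> g x) \<le> 2 * (norm (h x) * norm (g x))" by simp
    qed
  qed measurable
  moreover have "(LINT x|M. S i x \<bullet> g x) = 0" for i
    by (rule integral_inner_simple_function[OF sub L2_space_imp_integrable[OF g] zero S(1)])
  ultimately show ?thesis by (simp add: LIMSEQ_const_iff)
qed

text \<open>The event is split according to the last index at which the threshold is exceeded; since
  the sigma-fields decrease, this is a stopping time when time runs backwards.\<close>

lemma (in finite_measure) reverse_martingale_maximal:
  fixes W :: "nat \<Rightarrow> 'a \<Rightarrow> 'h::{real_inner, banach, second_countable_topology}"
  assumes sub: "\<And>k. subalgebra M (F k)" and dec: "\<And>k m. k \<le> m \<Longrightarrow> sets (F m) \<subseteq> sets (F k)"
    and L2: "\<And>m. m \<in> {N..n} \<Longrightarrow> W m \<in> L2_space M"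
    and meas: "\<And>m. m \<in> {N..n} \<Longrightarrow> W m \<in> borel_measurable (F m)"
    and mart: "\<And>m A. m \<in> {N..n} \<Longrightarrow> A \<in> sets (F m) \<Longrightarrow> (LINT x:A|M. W N x) = (LINT x:A|M. W m x)"
    and \<epsilon>: "0 \<le> \<epsilon>"
  shows "\<epsilon>\<^sup>2 * measure M {x \<in> space M. \<exists>m\<in>{N..n}. \<epsilon> \<le> norm (W m x)} \<le> (LINT x|M. (norm (W N x))\<^sup>2)"
proof (cases "N \<le> n")
  case False
  then show ?thesis by simp
next
  case True
  define A where "A m = {x \<in> space M. \<epsilon> \<le> norm (W m x) \<and> (\<forall>j\<in>{m<..n}. norm (W j x) < \<epsilon>)}" for m
  have sp: "space (F m) = space M" for m using sub[of m] by (simp add: subalgebra_def)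
  have subF: "subalgebra (F k) (F m)" if "k \<le> m" for k m
    using dec[OF that] sp by (simp add: subalgebra_def)
  \<comment> \<open>\<open>A m\<close> involves only \<open>W j\<close> with
    \<open>j \<ge> m\<close>, and these are \<open>F m\<close>-measurable because the fields
    decrease.\<close>
  have AF: "A m \<in> sets (F m)" if m: "m \<in> {N..n}" for m
  proof -
    have W [measurable]: "W j \<in> borel_measurable (F m)" if "j \<in> {m..n}" for j
      using measurable_from_subalg[OF subF[of m j] meas[of j]] that m by auto
    have [measurable]: "W m \<in> borel_measurable (F m)" by (rule meas[OF m])
    have "{x \<in> space (F m). \<epsilon> \<le> norm (W m x) \<and> (\<forall>j\<in>{m<..n}. norm (W j x) < \<epsilon>)} \<in> sets (F m)"
      by measurable
    then show ?thesis by (simp add: A_def sp)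
  qed
  then have AM [measurable]: "A m \<in> sets M" if "m \<in> {N..n}" for m
    using sub[of m] that by (auto simp: subalgebra_def)
  have disj: "disjoint_family_on A {N..n}"
    unfolding disjoint_family_on_def A_def by (auto simp: not_le) (metis greaterThanAtMost_iff linorder_less_linear not_le)
  have eq: "{x \<in> space M. \<exists>m\<in>{N..n}. \<epsilon> \<le> norm (W m x)} = (\<Union>m\<in>{N..n}. A m)"
  proof (intro equalityI subsetI)
    fix x assume x: "x \<in> {x \<in> space M. \<exists>m\<in>{N..n}. \<epsilon> \<le> norm (W m x)}"
    define J where "J = {m \<in> {N..n}. \<epsilon> \<le> norm (W m x)}"
    have J: "finite J" "J \<noteq> {}" using x by (auto simp: J_def)
    have "Max J \<in> J" using J by (rule Max_in)
    moreover have "norm (W j x) < \<epsilon>" if "j \<in> {Max J<..n}" for j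
    proof (rule ccontr)
      assume "\<not> norm (W j x) < \<epsilon>"
      with that \<open>Max J \<in> J\<close> have "j \<in> J" by (auto simp: J_def)
      with J have "j \<le> Max J" by simp
      with that show False by simp
    qed
    ultimately show "x \<in> (\<Union>m\<in>{N..n}. A m)" using x by (auto simp: J_def A_def)
  qed (auto simp: A_def)
  let ?i = "\<lambda>m x. indicator (A m) x :: real"
  have N: "W N \<in> L2_space M" using L2 True by simp
  have iL2: "(\<lambda>x. ?i m x *\<^sub>R W j x) \<in> L2_space M" if "m \<in> {N..n}" "j \<in> {N..n}" for m j
    using L2[OF that(2)] AM[OF that(1)] by (rule L2_space_indicator)
  have sq: "(norm (?i m x *\<^sub>R v))\<^sup>2 = ?i m x * (norm v)\<^sup>2" for m x and v :: 'h
    by (auto simp: indicator_def)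
  have int: "integrable M (\<lambda>x. ?i m x * (norm (W j x))\<^sup>2)" if "m \<in> {N..n}" "j \<in> {N..n}" for m j
    using L2_space_integrable[OF iL2[OF that]] by (simp only: sq)
  have step: "\<epsilon>\<^sup>2 * measure M (A m) \<le> (LINT x|M. ?i m x * (norm (W N x))\<^sup>2)" if m: "m \<in> {N..n}" for m
  proof -
    have D: "(\<lambda>x. W N x - W m x) \<in> L2_space M" using N L2[OF m] by (rule L2_space_diff)
    \<comment> \<open>\<open>W N - W m\<close> has zero integral over every set of
      \<open>F m\<close>, while the other factor is \<open>F m\<close>-measurable. Hence on
      \<open>A m\<close> the second moment of \<open>W N\<close> is that of \<open>W m\<close> plus
      that of the difference.\<close>
    have orth: "(LINT x|M. (?i m x *\<^sub>R W m x) \<bullet> (W N x - W m x)) = 0"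
    proof (rule integral_inner_eq_0[OF sub D])
      show "(\<lambda>x. ?i m x *\<^sub>R W m x) \<in> L2_space M" by (rule iL2[OF m m])
      show "(\<lambda>x. ?i m x *\<^sub>R W m x) \<in> borel_measurable (F m)"
        using meas[OF m] AF[OF m] by measurable
      fix B assume B: "B \<in> sets (F m)"
      then have BM: "B \<in> sets M" using sub[of m] by (auto simp: subalgebra_def)
      have "integrable M (\<lambda>x. indicator B x *\<^sub>R W j x)" if "j \<in> {N..n}" for j
        by (intro integrable_mult_indicator BM L2_space_imp_integrable L2 that)
      with mart[OF m B] m True show "(LINT x:B|M. W N x - W m x) = 0"
        by (subst set_integral_diff) (auto simp: set_integrable_def)
    qed
    have iD: "(\<lambda>x. ?i m x *\<^sub>R (W N x - W m x)) \<in> L2_space M"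
      using D AM[OF m] by (rule L2_space_indicator)
    have iA: "integrable M (\<lambda>x. ?i m x * \<epsilon>\<^sup>2)"
      using AM[OF m] by (simp add: less_top[symmetric])
    have "\<epsilon>\<^sup>2 * measure M (A m) = (LINT x|M. ?i m x * \<epsilon>\<^sup>2)"
      using AM[OF m] by simp
    also have "\<dots> \<le> (LINT x|M. ?i m x * (norm (W m x))\<^sup>2)"
      using \<epsilon> by (intro integral_mono iA int m) (auto simp: A_def indicator_def intro!: power_mono)
    also have "\<dots> = (LINT x|M. (norm (?i m x *\<^sub>R W m x))\<^sup>2)" by (simp only: sq)
    also have "\<dots> \<le> (LINT x|M. (norm (?i m x *\<^sub>R W m x + ?i m x *\<^sub>R (W N x - W m x)))\<^sup>2)"
    proof (subst integral_norm_sq_add[OF iL2[OF m m] iD])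
      have "(LINT x|M. (?i m x *\<^sub>R W m x) \<bullet> (?i m x *\<^sub>R (W N x - W m x)))
          = (LINT x|M. (?i m x *\<^sub>R W m x) \<bullet> (W N x - W m x))"
        by (intro Bochner_Integration.integral_cong) (auto simp: indicator_def)
      then show "(LINT x|M. (norm (?i m x *\<^sub>R W m x))\<^sup>2) \<le> (LINT x|M. (norm (?i m x *\<^sub>R W m x))\<^sup>2)
         + 2 * (LINT x|M. (?i m x *\<^sub>R W m x) \<bullet> (?i m x *\<^sub>R (W N x - W m x)))
         + (LINT x|M. (norm (?i m x *\<^sub>R (W N x - W m x)))\<^sup>2)"
        using orth by simp
    qed
    also have "\<dots> = (LINT x|M. ?i m x * (norm (W N x))\<^sup>2)"
      by (intro Bochner_Integration.integral_cong) (auto simp: indicator_def)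
    finally show ?thesis .
  qed
  have "\<epsilon>\<^sup>2 * measure M (\<Union>m\<in>{N..n}. A m) = (\<Sum>m\<in>{N..n}. \<epsilon>\<^sup>2 * measure M (A m))"
    by (subst finite_measure_finite_Union[OF _ _ disj]) (auto simp: sum_distrib_left)
  also have "\<dots> \<le> (\<Sum>m\<in>{N..n}. LINT x|M. ?i m x * (norm (W N x))\<^sup>2)"
    by (intro sum_mono step)
  also have "\<dots> = (LINT x|M. (\<Sum>m\<in>{N..n}. ?i m x * (norm (W N x))\<^sup>2))"
    using int True by (subst Bochner_Integration.integral_sum) auto
  also have "\<dots> \<le> (LINT x|M. (norm (W N x))\<^sup>2)"
  proof (rule integral_mono)
    show "integrable M (\<lambda>x. \<Sum>m\<in>{N..n}. ?i m x * (norm (W N x))\<^sup>2)"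
      using int True by (intro Bochner_Integration.integrable_sum) simp
    show "integrable M (\<lambda>x. (norm (W N x))\<^sup>2)" by (rule L2_space_integrable[OF N])
    fix x
    have "(\<Sum>m\<in>{N..n}. ?i m x) = indicator (\<Union>m\<in>{N..n}. A m) x"
      by (rule indicator_UN_disjoint[OF _ disj, symmetric]) simp
    also have "\<dots> \<le> 1" by (simp add: indicator_def)
    finally show "(\<Sum>m\<in>{N..n}. ?i m x * (norm (W N x))\<^sup>2) \<le> (norm (W N x))\<^sup>2"
      by (simp flip: sum_distrib_right add: mult_left_le_one_le sum_nonneg)
  qed
  finally show ?thesis by (simp add: eq)
qed

text \<open>Fatou's lemma for the squared norms, carried out with the nonnegative integral so that
  square integrability of the limit comes out as well as the bound.\<close>

lemma L2_Fatou:
  assumes f: "\<And>n. f n \<in> L2_space M" and lim: "AE x in M. (\<lambda>n. f n x) \<longlonglongrightarrow> g x"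
    and g [measurable]: "g \<in> borel_measurable M"
    and B: "\<And>n. (LINT x|M. (norm (f n x))\<^sup>2) \<le> B"
  shows "g \<in> L2_space M" "(LINT x|M. (norm (g x))\<^sup>2) \<le> B"
proof -
  note [measurable] = L2_space_measurable[OF f]
  \<comment> \<open>\<open>ennreal\<close> sends negative reals to 0, so reading the final bound
    back in the reals requires \<open>0 \<le> B\<close>.\<close>
  have "0 \<le> (LINT x|M. (norm (f 0 x))\<^sup>2)" by simp
  with B[of 0] have B0: "0 \<le> B" by linarith
  have "(\<integral>\<^sup>+ x. ennreal ((norm (g x))\<^sup>2) \<partial>M) = (\<integral>\<^sup>+ x. liminf (\<lambda>n. ennreal ((norm (f n x))\<^sup>2)) \<partial>M)"
  proof (rule nn_integral_cong_AE)
    from lim show "AE x in M. ennreal ((norm (g x))\<^sup>2) = liminf (\<lambda>n. ennreal ((norm (f n x))\<^sup>2))"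
    proof eventually_elim
      case (elim x)
      then have "(\<lambda>n. ennreal ((norm (f n x))\<^sup>2)) \<longlonglongrightarrow> ennreal ((norm (g x))\<^sup>2)"
        by (intro tendsto_intros)
      from lim_imp_Liminf[OF _ this] show ?case by simp
    qed
  qed
  also have "\<dots> \<le> liminf (\<lambda>n. \<integral>\<^sup>+ x. ennreal ((norm (f n x))\<^sup>2) \<partial>M)"
    by (rule nn_integral_liminf) measurable
  also have "\<dots> \<le> ennreal B"
  proof (rule Liminf_le)
    show "\<forall>\<^sub>F n in sequentially. (\<integral>\<^sup>+ x. ennreal ((norm (f n x))\<^sup>2) \<partial>M) \<le> ennreal B"
      using B by (intro always_eventually allI)
        (simp add: nn_integral_eq_integral[OF L2_space_integrable[OF f]] ennreal_leI)
  qed simp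
  finally have le: "(\<integral>\<^sup>+ x. ennreal ((norm (g x))\<^sup>2) \<partial>M) \<le> ennreal B" .
  show gL2: "g \<in> L2_space M"
  proof (rule L2_spaceI[OF g], rule integrableI_bounded)
    show "(\<integral>\<^sup>+ x. ennreal (norm ((norm (g x))\<^sup>2)) \<partial>M) < \<infinity>"
      using le by (simp add: le_less_trans[OF le])
  qed measurable
  show "(LINT x|M. (norm (g x))\<^sup>2) \<le> B"
    using le B0 by (simp add: nn_integral_eq_integral[OF L2_space_integrable[OF gL2]])
qed

section \<open>Square-integrable reverse martingales and their differences\<close>

text \<open>\<open>mart\<close> is the relation E(Y k | F (k + 1)) = Y (k + 1) in integrated form.
  Index 0 is included, so that the summations by parts can start there.\<close>

locale L2_reverse_martingale = prob_space M for M :: "'a measure" +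
  fixes F :: "nat \<Rightarrow> 'a measure"
    and Y :: "nat \<Rightarrow> 'a \<Rightarrow> 'h::{real_inner, banach, second_countable_topology}"
  assumes sub: "subalgebra M (F k)"
    and dec: "sets (F (Suc k)) \<subseteq> sets (F k)"
    and L2: "Y k \<in> L2_space M"
    and meas: "Y k \<in> borel_measurable (F k)"
    and mart: "A \<in> sets (F (Suc k)) \<Longrightarrow> (LINT x:A|M. Y k x) = (LINT x:A|M. Y (Suc k) x)"
begin

definition y :: "nat \<Rightarrow> real" where "y k = (LINT x|M. (norm (Y k x))\<^sup>2)"

definition D :: "nat \<Rightarrow> 'a \<Rightarrow> 'h" where "D k x = Y k x - Y (Suc k) x"

lemma y_nonneg: "0 \<le> y k"
  by (simp add: y_def)

lemma dec_le: "k \<le> m \<Longrightarrow> sets (F m) \<subseteq> sets (F k)"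
  using dec by (rule lift_Suc_antimono_le)

lemma sets_F: "A \<in> sets (F k) \<Longrightarrow> A \<in> sets M"
  using sub[of k] by (auto simp: subalgebra_def)

lemma measurable_F_le:
  assumes "k \<le> m" and f: "f \<in> borel_measurable (F m)"
  shows "f \<in> borel_measurable (F k)"
proof (rule measurable_from_subalg[OF _ f])
  show "subalgebra (F k) (F m)"
    using dec_le[OF assms(1)] sub[of k] sub[of m] by (simp add: subalgebra_def)
qed

lemma L2_set_integrable: "f \<in> L2_space M \<Longrightarrow> A \<in> sets (F k) \<Longrightarrow> set_integrable M A f"
  unfolding set_integrable_def
  by (intro integrable_mult_indicator sets_F L2_space_imp_integrable)

lemma mart_le: "k \<le> m \<Longrightarrow> A \<in> sets (F m) \<Longrightarrow> (LINT x:A|M. Y k x) = (LINT x:A|M. Y m x)"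
proof (induction m rule: dec_induct)
  case (step m)
  then show ?case using dec[of m] mart[of A m] by auto
qed simp

lemma D_L2: "D k \<in> L2_space M"
  using L2_space_diff[OF L2 L2, of k "Suc k"] by (simp add: D_def[abs_def])

lemma D_measurable: "D k \<in> borel_measurable (F k)"
proof -
  have [measurable]: "Y k \<in> borel_measurable (F k)" "Y (Suc k) \<in> borel_measurable (F k)"
    using meas measurable_F_le[of k "Suc k"] by auto
  show ?thesis unfolding D_def by measurable
qed

lemma D_zero: "k < m \<Longrightarrow> A \<in> sets (F m) \<Longrightarrow> (LINT x:A|M. D k x) = 0"
  unfolding D_def using mart_le[of k m A] mart_le[of "Suc k" m A]
  by (subst set_integral_diff) (auto intro: L2_set_integrable[OF L2])

text \<open>Pythagoras for Y k = Y (k + 1) + D k: the first summand is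
  \<open>F (Suc k)\<close>-measurable, and \<open>D k\<close> has zero integral over the sets of
  that field.\<close>

lemma y_Suc: "y k = y (Suc k) + (LINT x|M. (norm (D k x))\<^sup>2)"
proof -
  have "(LINT x|M. Y (Suc k) x \<bullet> D k x) = 0"
    by (rule integral_inner_eq_0[OF sub[of "Suc k"] D_L2 _ L2 meas]) (rule D_zero[OF lessI])
  then show ?thesis
    using integral_norm_sq_add[OF L2[of "Suc k"] D_L2[of k]] by (simp add: y_def D_def)
qed

lemma y_antimono: "k \<le> m \<Longrightarrow> y m \<le> y k"
proof (rule lift_Suc_antimono_le[of y])
  show "y (Suc k) \<le> y k" for k using y_Suc[of k] by simp
qed

section \<open>Sums of differences with deterministic coefficients\<close>

context
  fixes s :: "nat \<Rightarrow> real"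
begin

lemma transform_L2: "(\<lambda>x. \<Sum>i\<in>I. s i *\<^sub>R D i x) \<in> L2_space M"
  by (intro L2_space_sum L2_space_scaleR D_L2)

lemma transform_measurable: "(\<lambda>x. \<Sum>i=n..<m. s i *\<^sub>R D i x) \<in> borel_measurable (F n)"
proof (rule borel_measurable_sum)
  fix i assume "i \<in> {n..<m}"
  then have [measurable]: "D i \<in> borel_measurable (F n)"
    using measurable_F_le[OF _ D_measurable, of n i] by simp
  show "(\<lambda>x. s i *\<^sub>R D i x) \<in> borel_measurable (F n)" by measurable
qed

text \<open>All indices lie below \<open>m\<close>, so every summand has conditional expectation 0
  given \<open>F m\<close>. Together with \<open>transform_measurable\<close> this makes the sums
  over \<open>m..<n\<close>, for fixed \<open>n\<close>, a reverse martingale in the lower limit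
  \<open>m\<close>.\<close>

lemma transform_zero:
  assumes "A \<in> sets (F m)"
  shows "(LINT x:A|M. (\<Sum>i=n..<m. s i *\<^sub>R D i x)) = 0"
proof -
  have "(LINT x:A|M. (\<Sum>i=n..<m. s i *\<^sub>R D i x)) = (\<Sum>i=n..<m. LINT x:A|M. s i *\<^sub>R D i x)"
    using L2_set_integrable[OF L2_space_scaleR[OF D_L2] assms]
    by (simp only: set_lebesgue_integral_def set_integrable_def scaleR_sum_right Bochner_Integration.integral_sum)
  also have "\<dots> = 0" using D_zero[OF _ assms] by (intro sum.neutral) auto
  finally show ?thesis .
qed

text \<open>Induction on the upper limit: the new term \<open>s m *\<^sub>R D m x\<close> is
  \<open>F m\<close>-measurable, hence orthogonal to the earlier sum, whose conditional expectation
  given \<open>F m\<close> is 0.\<close>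

lemma transform_second_moment:
  "(LINT x|M. (norm (\<Sum>i=n..<m. s i *\<^sub>R D i x))\<^sup>2) = (\<Sum>i=n..<m. (s i)\<^sup>2 * (y i - y (Suc i)))"
proof (cases "n \<le> m")
  case True
  then show ?thesis
  proof (induction m rule: dec_induct)
    case (step m)
    have "(LINT x|M. (s m *\<^sub>R D m x) \<bullet> (\<Sum>i=n..<m. s i *\<^sub>R D i x)) = 0"
      by (rule integral_inner_eq_0[OF sub[of m] transform_L2 transform_zero L2_space_scaleR[OF D_L2]])
        (assumption, intro borel_measurable_scaleR borel_measurable_const D_measurable)
    then have "(LINT x|M. (norm (s m *\<^sub>R D m x + (\<Sum>i=n..<m. s i *\<^sub>R D i x)))\<^sup>2)
      = (s m)\<^sup>2 * (LINT x|M. (norm (D m x))\<^sup>2) + (\<Sum>i=n..<m. (s i)\<^sup>2 * (y i - y (Suc i)))"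
      by (subst integral_norm_sq_add[OF L2_space_scaleR[OF D_L2] transform_L2])
        (simp add: step.IH power_mult_distrib)
    then show ?case using step.hyps y_Suc[of m] by (simp add: add.commute)
  qed simp
qed simp

lemma transform_maximal:
  assumes \<epsilon>: "0 \<le> \<epsilon>"
  shows "\<epsilon>\<^sup>2 * prob {x \<in> space M. \<exists>m\<in>{N..n}. \<epsilon> \<le> norm (\<Sum>i=m..<n. s i *\<^sub>R D i x)}
    \<le> (\<Sum>i=N..<n. (s i)\<^sup>2 * (y i - y (Suc i)))"
proof -
  have "\<epsilon>\<^sup>2 * prob {x \<in> space M. \<exists>m\<in>{N..n}. \<epsilon> \<le> norm (\<Sum>i=m..<n. s i *\<^sub>R D i x)}
    \<le> (LINT x|M. (norm (\<Sum>i=N..<n. s i *\<^sub>R D i x))\<^sup>2)"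
  proof (rule reverse_martingale_maximal[OF sub dec_le transform_L2 transform_measurable _ \<epsilon>])
    fix m A assume m: "m \<in> {N..n}" and A: "A \<in> sets (F m)"
    have "(LINT x:A|M. (\<Sum>i=N..<n. s i *\<^sub>R D i x)) =
      (LINT x:A|M. (\<Sum>i=N..<m. s i *\<^sub>R D i x) + (\<Sum>i=m..<n. s i *\<^sub>R D i x))"
      using m by (simp add: sum.atLeastLessThan_concat)
    also have "\<dots> = (LINT x:A|M. (\<Sum>i=m..<n. s i *\<^sub>R D i x))"
      by (subst set_integral_add) (simp_all add: L2_set_integrable[OF transform_L2 A] transform_zero[OF A])
    finally show "(LINT x:A|M. (\<Sum>i=N..<n. s i *\<^sub>R D i x)) = (LINT x:A|M. (\<Sum>i=m..<n. s i *\<^sub>R D i x))" .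
  qed
  then show ?thesis by (simp add: transform_second_moment)
qed

text \<open>Doob's inequality controls sums with a moving lower limit, whereas convergence concerns
  a moving upper limit. The sum over \<open>N..<m\<close> is the difference of those over
  \<open>N..<n\<close> and \<open>m..<n\<close>, so if its norm reaches
  \<open>2 * \<epsilon>\<close>, one of these two has norm at least
  \<open>\<epsilon>\<close>.\<close>

lemma transform_oscillation:
  assumes \<epsilon>: "0 \<le> \<epsilon>" and sm: "summable (\<lambda>i. (s i)\<^sup>2 * (y i - y (Suc i)))"
  shows "\<epsilon>\<^sup>2 * prob {x \<in> space M. \<exists>m\<ge>N. 2 * \<epsilon> \<le> norm (\<Sum>i=N..<m. s i *\<^sub>R D i x)}
    \<le> (\<Sum>i. (s (i + N))\<^sup>2 * (y (i + N) - y (Suc (i + N))))"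
proof -
  let ?V = "\<lambda>m n x. \<Sum>i=m..<n. s i *\<^sub>R D i x"
  let ?E = "\<lambda>n. {x \<in> space M. \<exists>m\<in>{N..n}. 2 * \<epsilon> \<le> norm (?V N m x)}"
  have [measurable]: "D i \<in> borel_measurable M" for i using D_L2 by (rule L2_space_measurable)
  have le: "\<epsilon>\<^sup>2 * prob (?E n) \<le> (\<Sum>i. (s (i + N))\<^sup>2 * (y (i + N) - y (Suc (i + N))))" for n
  proof -
    have "?E n \<subseteq> {x \<in> space M. \<exists>m\<in>{N..n}. \<epsilon> \<le> norm (?V m n x)}"
    proof safe
      fix x m assume m: "m \<in> {N..n}" and x: "2 * \<epsilon> \<le> norm (?V N m x)"
      have "?V N m x = ?V N n x - ?V m n x"
        using m sum.atLeastLessThan_concat[of N m n "\<lambda>i. s i *\<^sub>R D i x"] by (simp add: algebra_simps)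
      then have "norm (?V N m x) \<le> norm (?V N n x) + norm (?V m n x)"
        by (metis norm_triangle_ineq4)
      with x have "\<epsilon> \<le> norm (?V N n x) \<or> \<epsilon> \<le> norm (?V m n x)" by linarith
      with m show "\<exists>m\<in>{N..n}. \<epsilon> \<le> norm (?V m n x)" by auto
    qed
    then have "\<epsilon>\<^sup>2 * prob (?E n) \<le> \<epsilon>\<^sup>2 * prob {x \<in> space M. \<exists>m\<in>{N..n}. \<epsilon> \<le> norm (?V m n x)}"
      by (intro mult_left_mono finite_measure_mono) measurable
    also have "\<dots> \<le> (\<Sum>i=N..<n. (s i)\<^sup>2 * (y i - y (Suc i)))" by (rule transform_maximal[OF \<epsilon>])
    also have "\<dots> = (\<Sum>i<n - N. (s (i + N))\<^sup>2 * (y (i + N) - y (Suc (i + N))))"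
    proof (cases "N \<le> n")
      case True
      then show ?thesis
        using sum.shift_bounds_nat_ivl[of "\<lambda>i. (s i)\<^sup>2 * (y i - y (Suc i))" 0 N "n - N"]
        by (simp add: atLeast0LessThan)
    qed simp
    also have "\<dots> \<le> (\<Sum>i. (s (i + N))\<^sup>2 * (y (i + N) - y (Suc (i + N))))"
      using summable_ignore_initial_segment[OF sm, of N]
      by (intro sum_le_suminf) (auto intro!: mult_nonneg_nonneg simp: y_antimono)
    finally show ?thesis .
  qed
  \<comment> \<open>The bound is uniform in \<open>n\<close> and the events increase, so continuity
    from below removes the upper limit.\<close>
  have "(\<lambda>n. prob (?E n)) \<longlonglongrightarrow> prob (\<Union>n. ?E n)"
  proof (rule finite_Lim_measure_incseq)
    show "range ?E \<subseteq> sets M" by auto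
    show "incseq ?E" by (rule incseq_SucI) auto
  qed
  then have "(\<lambda>n. \<epsilon>\<^sup>2 * prob (?E n)) \<longlonglongrightarrow> \<epsilon>\<^sup>2 * prob (\<Union>n. ?E n)"
    by (rule tendsto_mult_left)
  moreover have "(\<Union>n. ?E n) = {x \<in> space M. \<exists>m\<ge>N. 2 * \<epsilon> \<le> norm (?V N m x)}"
    by (auto, meson atLeastAtMost_iff order_refl)
  ultimately show ?thesis using le by (auto intro: LIMSEQ_le_const2)
qed

lemma transform_tail:
  assumes "summable (\<lambda>i. (s i)\<^sup>2 * (y i - y (Suc i)))"
  shows "(\<lambda>N. \<Sum>i. (s (i + N))\<^sup>2 * (y (i + N) - y (Suc (i + N)))) \<longlonglongrightarrow> 0"
  using suminf_exist_split2[OF assms] by simp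

text \<open>The oscillation bound tends to 0 with \<open>N\<close>, so almost surely some
  \<open>N\<close> has all later sums within \<open>2 * \<epsilon>\<close> of the one at
  \<open>N\<close>. Countably many \<open>\<epsilon>\<close> give the Cauchy property, and the space
  is complete.\<close>

lemma transform_AE_convergent:
  assumes sm: "summable (\<lambda>i. (s i)\<^sup>2 * (y i - y (Suc i)))"
  shows "AE x in M. convergent (\<lambda>n. \<Sum>i<n. s i *\<^sub>R D i x)"
proof -
  let ?V = "\<lambda>m n x. \<Sum>i=m..<n. s i *\<^sub>R D i x"
  have [measurable]: "D i \<in> borel_measurable M" for i using D_L2 by (rule L2_space_measurable)
  have "AE x in M. \<exists>N. \<forall>m\<ge>N. norm (?V N m x) < 2 * \<epsilon>" if \<epsilon>: "\<epsilon> > 0" for \<epsilon>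
  proof -
    define B where "B N = {x \<in> space M. \<exists>m\<ge>N. 2 * \<epsilon> \<le> norm (?V N m x)}" for N
    have [measurable]: "B N \<in> sets M" for N unfolding B_def by measurable
    \<comment> \<open>The bad event lies in every \<open>B N\<close>, hence its probability is
      bounded by every tail of a convergent series.\<close>
    have "\<epsilon>\<^sup>2 * prob (\<Inter>N. B N) \<le> (\<Sum>i. (s (i + N))\<^sup>2 * (y (i + N) - y (Suc (i + N))))" for N
    proof -
      have "\<epsilon>\<^sup>2 * prob (\<Inter>N. B N) \<le> \<epsilon>\<^sup>2 * prob (B N)"
        by (intro mult_left_mono finite_measure_mono) auto
      also have "\<dots> \<le> (\<Sum>i. (s (i + N))\<^sup>2 * (y (i + N) - y (Suc (i + N))))"
        using transform_oscillation[OF _ sm, of \<epsilon> N] \<epsilon> by (simp add: B_def)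
      finally show ?thesis .
    qed
    then have "\<epsilon>\<^sup>2 * prob (\<Inter>N. B N) \<le> 0"
      using transform_tail[OF sm] by (intro LIMSEQ_le_const[of _ 0]) auto
    then have "prob (\<Inter>N. B N) = 0"
      using \<epsilon> measure_nonneg[of M "\<Inter>N. B N"] by (simp add: mult_le_0_iff power2_eq_square antisym)
    then have "AE x in M. x \<notin> (\<Inter>N. B N)"
      by (subst (asm) prob_eq_0) auto
    then show ?thesis
      by (rule AE_mp) (rule AE_I2, force simp: B_def not_le)
  qed
  then have "AE x in M. \<forall>k::nat. \<exists>N. \<forall>m\<ge>N. norm (?V N m x) < 2 * inverse (real (Suc k))"
    unfolding AE_all_countable by simp
  then show ?thesis
  proof eventually_elim
    case (elim x)
    have "Cauchy (\<lambda>n. \<Sum>i<n. s i *\<^sub>R D i x)"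
    proof (rule metric_CauchyI)
      fix e :: real assume "e > 0"
      \<comment> \<open>Two sums are compared through index \<open>N\<close>; each contributes less
        than 2/(k + 1) < e/2, whence the \<open>e / 4\<close>.\<close>
      then obtain k where k: "inverse (real (Suc k)) < e / 4"
        using reals_Archimedean[of "e / 4"] by auto
      obtain N where N: "\<And>m. m \<ge> N \<Longrightarrow> norm (?V N m x) < 2 * inverse (real (Suc k))"
        using elim by blast
      have V: "(\<Sum>i<m. s i *\<^sub>R D i x) = (\<Sum>i<N. s i *\<^sub>R D i x) + ?V N m x" if "m \<ge> N" for m
        using that sum.atLeastLessThan_concat[of 0 N m "\<lambda>i. s i *\<^sub>R D i x"]
        by (simp add: atLeast0LessThan)
      show "\<exists>N. \<forall>m\<ge>N. \<forall>n\<ge>N. dist (\<Sum>i<m. s i *\<^sub>R D i x) (\<Sum>i<n. s i *\<^sub>R D i x) < e"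
      proof (intro exI allI impI)
        fix m n assume mn: "m \<ge> N" "n \<ge> N"
        have "dist (\<Sum>i<m. s i *\<^sub>R D i x) (\<Sum>i<n. s i *\<^sub>R D i x) = norm (?V N m x - ?V N n x)"
          by (simp add: V[OF mn(1)] V[OF mn(2)] dist_norm)
        also have "\<dots> \<le> norm (?V N m x) + norm (?V N n x)" by (rule norm_triangle_ineq4)
        also have "\<dots> < e" using N[OF mn(1)] N[OF mn(2)] k by linarith
        finally show "dist (\<Sum>i<m. s i *\<^sub>R D i x) (\<Sum>i<n. s i *\<^sub>R D i x) < e" .
      qed
    qed
    then show ?case by (rule Cauchy_convergent)
  qed
qed

end

end

section \<open>Dyadic blocks\<close>

text \<open>The exponent is shifted by one: the block from \<open>2 ^ Suc j\<close> to
  \<open>2 ^ Suc (Suc j)\<close> is later paid for by the summands with indices in the preceding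
  block, from \<open>2 ^ j\<close> to \<open>2 ^ Suc j\<close>.\<close>

lemma dyadic_interval:
  fixes n :: nat
  assumes "2 ^ Suc J \<le> n"
  obtains j where "J \<le> j" "2 ^ Suc j \<le> n" "n < 2 ^ Suc (Suc j)"
proof -
  have "1 \<le> n" using assms one_le_power[of "2::nat" "Suc J"] by linarith
  then obtain i where i: "2 ^ i \<le> n" "n < 2 ^ Suc i"
    using ex_power_ivl1[of 2 n] by auto
  have "(2::nat) ^ Suc J < 2 ^ Suc i" using assms i by linarith
  then have "Suc J \<le> i" using power_less_imp_less_exp[of "2::nat" "Suc J" "Suc i"] by simp
  then show ?thesis using that[of "i - 1"] i by (cases i) auto
qed

lemma dyadic_tendsto_0:
  fixes f :: "nat \<Rightarrow> 'b::real_normed_vector" and g :: "nat \<Rightarrow> real"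
  assumes g: "g \<longlonglongrightarrow> 0"
    and le: "\<And>j n. 2 ^ Suc j \<le> n \<Longrightarrow> n < 2 ^ Suc (Suc j) \<Longrightarrow> norm (f n) \<le> g j"
  shows "f \<longlonglongrightarrow> 0"
proof (rule LIMSEQ_I)
  fix r :: real assume "0 < r"
  then obtain J where J: "\<And>j. J \<le> j \<Longrightarrow> norm (g j) < r"
    using LIMSEQ_D[OF g] by auto
  show "\<exists>N. \<forall>n\<ge>N. norm (f n - 0) < r"
  proof (intro exI allI impI)
    fix n :: nat assume "2 ^ Suc J \<le> n"
    then obtain j where j: "J \<le> j" "2 ^ Suc j \<le> n" "n < 2 ^ Suc (Suc j)" by (rule dyadic_interval)
    show "norm (f n - 0) < r" using le[OF j(2,3)] J[OF j(1)] by simp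
  qed
qed

text \<open>A condensation argument. It explains the argument \<open>4 * k\<close>: for
  \<open>k\<close> in \<open>{n..<2 * n}\<close> the value \<open>c (4 * k)\<close> is at least
  \<open>c (4 * n)\<close>, which in turn bounds \<open>c\<close> on the whole next block up to
  \<open>4 * n\<close>.\<close>

lemma dyadic_summable:
  fixes c y :: "nat \<Rightarrow> real"
  assumes mono: "\<And>i j. 1 \<le> i \<Longrightarrow> i \<le> j \<Longrightarrow> c i \<le> c j" and nonneg: "\<And>i. 1 \<le> i \<Longrightarrow> 0 \<le> c i"
    and anti: "\<And>i j. i \<le> j \<Longrightarrow> y j \<le> y i" and y0: "\<And>i. 0 \<le> y i"
    and sm: "summable (\<lambda>k. (c (4 * k))\<^sup>2 / real k * y k)"
  shows "summable (\<lambda>j. (c (2 ^ Suc (Suc j)))\<^sup>2 * y (2 ^ Suc j))"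
proof -
  define f where "f k = (c (4 * k))\<^sup>2 / real k * y k" for k
  have f0: "0 \<le> f k" for k by (simp add: f_def y0)
  \<comment> \<open>Each of the \<open>n\<close> summands is at least
    \<open>(c (4 * n))\<^sup>2 * y (2 * n) / (2 * n)\<close>; adding them costs only the factor
    2.\<close>
  have block: "(c (4 * n))\<^sup>2 * y (2 * n) \<le> 2 * (\<Sum>k=n..<2 * n. f k)" if n: "1 \<le> n" for n
  proof -
    have "(c (4 * n))\<^sup>2 / (2 * real n) * y (2 * n) \<le> f k" if k: "k \<in> {n..<2 * n}" for k
      unfolding f_def
    proof (intro mult_mono frac_le)
      show "(c (4 * n))\<^sup>2 \<le> (c (4 * k))\<^sup>2" using k n by (intro power_mono mono nonneg) auto
    qed (use k n y0 anti in auto)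
    then have "(\<Sum>k=n..<2 * n. (c (4 * n))\<^sup>2 / (2 * real n) * y (2 * n)) \<le> (\<Sum>k=n..<2 * n. f k)"
      by (rule sum_mono)
    then show ?thesis using n by simp
  qed
  \<comment> \<open>The blocks from \<open>2 ^ j\<close> to \<open>2 ^ Suc j\<close> with
    \<open>j < J\<close> are disjoint and fill \<open>{1..<2 ^ J}\<close>.\<close>
  have partial: "(\<Sum>j<J. (c (2 ^ Suc (Suc j)))\<^sup>2 * y (2 ^ Suc j)) \<le> 2 * (\<Sum>k=1..<2 ^ J. f k)" for J
  proof (induction J)
    case (Suc J)
    have "(\<Sum>k=1..<2 ^ Suc J. f k) = (\<Sum>k=1..<2 ^ J. f k) + (\<Sum>k=2 ^ J..<2 * 2 ^ J. f k)"
      by (subst sum.atLeastLessThan_concat) auto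
    with Suc block[of "2 ^ J"] show ?case by (simp add: mult.assoc)
  qed simp
  show ?thesis
  proof (rule summableI_nonneg_bounded)
    show "0 \<le> (c (2 ^ Suc (Suc j)))\<^sup>2 * y (2 ^ Suc j)" for j by (simp add: y0)
    show "(\<Sum>j<J. (c (2 ^ Suc (Suc j)))\<^sup>2 * y (2 ^ Suc j)) \<le> 2 * suminf f" for J
    proof -
      have "(\<Sum>k=1..<2 ^ J. f k) \<le> suminf f"
        using sm f0 by (intro sum_le_suminf) (auto simp: f_def[abs_def])
      with partial[of J] show ?thesis by linarith
    qed
  qed
qed

context L2_reverse_martingale
begin

text \<open>The factor \<open>r\<close> is the same for all \<open>m\<close>, so the martingale
  property survives. The varying factors s m must first be replaced by a bound valid on a whole
  block.\<close>

lemma scaled_maximal: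
  assumes "0 \<le> \<epsilon>"
  shows "\<epsilon>\<^sup>2 * prob {x \<in> space M. \<exists>m\<in>{N..n}. \<epsilon> \<le> norm (r *\<^sub>R Y m x)} \<le> r\<^sup>2 * y N"
proof -
  have "\<epsilon>\<^sup>2 * prob {x \<in> space M. \<exists>m\<in>{N..n}. \<epsilon> \<le> norm (r *\<^sub>R Y m x)} \<le> (LINT x|M. (norm (r *\<^sub>R Y N x))\<^sup>2)"
  proof (rule reverse_martingale_maximal[OF sub dec_le L2_space_scaleR[OF L2] _ _ assms])
    fix m A assume m: "m \<in> {N..n}"
    show "(\<lambda>x. r *\<^sub>R Y m x) \<in> borel_measurable (F m)"
      by (intro borel_measurable_scaleR borel_measurable_const meas)
    assume "A \<in> sets (F m)"
    then show "(LINT x:A|M. r *\<^sub>R Y N x) = (LINT x:A|M. r *\<^sub>R Y m x)"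
      using mart_le[of N m A] m by (simp only: set_integral_scaleR_right) simp
  qed
  then show ?thesis by (simp add: power_mult_distrib y_def)
qed

section \<open>The boundary term s n Y n\<close>

text \<open>\<open>c\<close> stands for a nondecreasing majorant of the absolute values of
  \<open>s\<close>, later \<open>psum_max a\<close>. Index 0 is excluded because
  \<open>psum_max a 0\<close> is the maximum of an empty set; in \<open>sm\<close> the term at
  \<open>k = 0\<close> is 0, as division by 0 gives 0.\<close>

context
  fixes s c :: "nat \<Rightarrow> real"
  assumes c_mono: "\<And>i j. 1 \<le> i \<Longrightarrow> i \<le> j \<Longrightarrow> c i \<le> c j"
    and s_le: "\<And>i j. 1 \<le> i \<Longrightarrow> i \<le> j \<Longrightarrow> \<bar>s i\<bar> \<le> c j"
    and sm: "summable (\<lambda>k. (c (4 * k))\<^sup>2 / real k * y k)"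
begin

lemma c_nonneg: "1 \<le> i \<Longrightarrow> 0 \<le> c i"
  using s_le[of i i] by simp

lemma dyadic_summable_y: "summable (\<lambda>j. (c (2 ^ Suc (Suc j)))\<^sup>2 * y (2 ^ Suc j))"
  using c_mono c_nonneg y_antimono y_nonneg sm by (rule dyadic_summable)

lemma scaled_tendsto_L2: "(\<lambda>n. (s n)\<^sup>2 * y n) \<longlonglongrightarrow> 0"
\<comment> \<open>On block \<open>j\<close> the second moment is at most the \<open>j\<close>-th
  term of the convergent dyadic series.\<close>
proof (rule dyadic_tendsto_0[OF summable_LIMSEQ_zero[OF dyadic_summable_y]])
  fix j n :: nat assume j: "2 ^ Suc j \<le> n" "n < 2 ^ Suc (Suc j)"
  have "1 \<le> n" using j(1) one_le_power[of "2::nat" "Suc j"] by linarith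
  then have "\<bar>s n\<bar> \<le> c (2 ^ Suc (Suc j))" using j(2) by (intro s_le) auto
  then have "\<bar>s n\<bar>\<^sup>2 \<le> (c (2 ^ Suc (Suc j)))\<^sup>2" by (intro power_mono) auto
  then show "norm ((s n)\<^sup>2 * y n) \<le> (c (2 ^ Suc (Suc j)))\<^sup>2 * y (2 ^ Suc j)"
    using y_antimono[OF j(1)] y_nonneg by (simp add: mult_mono)
qed

lemma scaled_tendsto_AE: "AE x in M. (\<lambda>n. s n *\<^sub>R Y n x) \<longlonglongrightarrow> 0"
proof -
  note [measurable] = L2_space_measurable[OF L2]
  have ev: "AE x in M. eventually (\<lambda>n. norm (s n *\<^sub>R Y n x) < \<epsilon>) sequentially" if \<epsilon>: "\<epsilon> > 0" for \<epsilon>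
  proof -
    \<comment> \<open>With the constant \<open>c (2 ^ Suc (Suc j))\<close> in place of
      \<open>s m\<close>, Doob's inequality bounds the probability of \<open>A j\<close> by a
      multiple of the \<open>j\<close>-th dyadic term, so Borel-Cantelli applies.\<close>
    define A where "A j = {x \<in> space M. \<exists>m\<in>{2 ^ Suc j..2 ^ Suc (Suc j)}. \<epsilon> \<le> norm (c (2 ^ Suc (Suc j)) *\<^sub>R Y m x)}" for j
    have [measurable]: "A j \<in> sets M" for j unfolding A_def by measurable
    have "norm (prob (A j)) \<le> (1 / \<epsilon>\<^sup>2) * ((c (2 ^ Suc (Suc j)))\<^sup>2 * y (2 ^ Suc j))" for j
      using scaled_maximal[of \<epsilon> "2 ^ Suc j" "2 ^ Suc (Suc j)" "c (2 ^ Suc (Suc j))"] \<epsilon>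
      by (simp add: A_def field_simps)
    then have "summable (\<lambda>j. prob (A j))"
      by (rule summable_comparison_test'[OF summable_mult[OF dyadic_summable_y], of 0])
    then have "AE x in M. eventually (\<lambda>j. x \<in> space M - A j) sequentially"
      by (intro borel_cantelli_AE1) (auto simp: emeasure_eq_measure)
    then show ?thesis
    proof eventually_elim
      case (elim x)
      then obtain J where J: "\<And>j. J \<le> j \<Longrightarrow> x \<in> space M - A j" by (auto simp: eventually_sequentially)
      show ?case unfolding eventually_sequentially
      proof (intro exI allI impI)
        fix n :: nat assume "2 ^ Suc J \<le> n"
        then obtain j where j: "J \<le> j" "2 ^ Suc j \<le> n" "n < 2 ^ Suc (Suc j)" by (rule dyadic_interval)
        have "1 \<le> n" using j(2) one_le_power[of "2::nat" "Suc j"] by linarith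
        then have "\<bar>s n\<bar> \<le> c (2 ^ Suc (Suc j))" using j(3) by (intro s_le) auto
        then have "norm (s n *\<^sub>R Y n x) \<le> norm (c (2 ^ Suc (Suc j)) *\<^sub>R Y n x)"
          by (simp add: mult_right_mono)
        also have "\<dots> < \<epsilon>"
          using J[OF j(1)] j(2,3) by (auto simp: A_def not_le)
        finally show "norm (s n *\<^sub>R Y n x) < \<epsilon>" .
      qed
    qed
  qed
  have "AE x in M. \<forall>k::nat. eventually (\<lambda>n. norm (s n *\<^sub>R Y n x) < inverse (real (Suc k))) sequentially"
    unfolding AE_all_countable by (intro allI ev) simp
  then show ?thesis
  proof eventually_elim
    case (elim x)
    show ?case
    proof (rule tendstoI)
      fix e :: real assume "0 < e"
      then obtain k where k: "inverse (real (Suc k)) < e" using reals_Archimedean by blast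
      from elim have "eventually (\<lambda>n. norm (s n *\<^sub>R Y n x) < inverse (real (Suc k))) sequentially" ..
      then show "eventually (\<lambda>n. dist (s n *\<^sub>R Y n x) 0 < e) sequentially"
        by eventually_elim (use k in simp)
    qed
  qed
qed

end

end

section \<open>Partial sums, weights and summation by parts\<close>

lemma psum_0 [simp]: "psum a 0 = 0"
  by (simp add: psum_def)

lemma psum_Suc [simp]: "psum a (Suc k) = psum a k + a (Suc k)"
  by (simp add: psum_def)

lemma abs_psum_le_psum_max: "1 \<le> i \<Longrightarrow> i \<le> j \<Longrightarrow> \<bar>psum a i\<bar> \<le> psum_max a j"
  unfolding psum_max_def by (rule Max_ge) auto

lemma psum_max_mono: "1 \<le> i \<Longrightarrow> i \<le> j \<Longrightarrow> psum_max a i \<le> psum_max a j"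
  unfolding psum_max_def by (rule Max_mono) auto

lemma weight_nonneg: "0 \<le> weight a k"
  by (simp add: weight_def le_max_iff_disj)

context L2_reverse_martingale
begin

text \<open>The term \<open>i = 0\<close> on the right vanishes because \<open>psum a 0 = 0\<close>,
  so \<open>Y 0\<close> does not enter.\<close>

lemma abel_vector:
  "(\<Sum>i=1..n. a i *\<^sub>R Y i x) = psum a n *\<^sub>R Y n x + (\<Sum>i<n. psum a i *\<^sub>R D i x)"
  by (induction n) (simp_all add: D_def algebra_simps)

text \<open>Summation by parts for the squared partial sums; the coefficients on the right are the
  second entry of the maximum in \<open>weight\<close>.\<close>

lemma abel_real:
  "(\<Sum>i<n. (psum a i)\<^sup>2 * (y i - y (Suc i))) + (psum a n)\<^sup>2 * y n
    = (\<Sum>i<n. ((psum a (Suc i))\<^sup>2 - (psum a i)\<^sup>2) * y (Suc i))"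
proof (induction n)
  case (Suc n)
  then show ?case by (simp del: psum_Suc add: left_diff_distrib right_diff_distrib)
qed simp

lemma weighted_sum_converges:
  assumes sm: "summable (\<lambda>k. weight a (Suc k) * y (Suc k))"
  shows "\<exists>Z. tendsto_L2 M (\<lambda>n \<omega>. \<Sum>i=1..n. a i *\<^sub>R Y i \<omega>) Z \<and>
             (AE \<omega> in M. (\<lambda>n. \<Sum>i=1..n. a i *\<^sub>R Y i \<omega>) \<longlonglongrightarrow> Z \<omega>)"
proof -
  define S where "S n \<omega> = (\<Sum>i=1..n. a i *\<^sub>R Y i \<omega>)" for n \<omega>
  define U where "U n \<omega> = (\<Sum>i<n. psum a i *\<^sub>R D i \<omega>)" for n \<omega>
  \<comment> \<open>\<open>R N\<close> is the second moment left in the series of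
    \<open>psum a i *\<^sub>R D i\<close> from index \<open>N\<close> on.\<close>
  define R where "R N = (\<Sum>i. (psum a (i + N))\<^sup>2 * (y (i + N) - y (Suc (i + N))))" for N
  have S: "S n \<omega> = psum a n *\<^sub>R Y n \<omega> + U n \<omega>" for n \<omega>
    unfolding S_def U_def by (rule abel_vector)
  have SL2: "S n \<in> L2_space M" and UL2: "U n \<in> L2_space M" for n
    unfolding S_def[abs_def] U_def[abs_def] by (intro L2_space_sum L2_space_scaleR L2 D_L2)+
  note [measurable] = L2_space_measurable[OF SL2] L2_space_measurable[OF UL2]

  have "summable (\<lambda>k. (psum_max a (4 * Suc k))\<^sup>2 / real (Suc k) * y (Suc k))"
  proof (rule summable_comparison_test'[OF sm, of 0])
    fix k
    have "(psum_max a (4 * Suc k))\<^sup>2 / real (Suc k) \<le> weight a (Suc k)"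
      unfolding weight_def by (rule max.cobounded1)
    then have "(psum_max a (4 * Suc k))\<^sup>2 / real (Suc k) * y (Suc k) \<le> weight a (Suc k) * y (Suc k)"
      by (rule mult_right_mono[OF _ y_nonneg])
    then show "norm ((psum_max a (4 * Suc k))\<^sup>2 / real (Suc k) * y (Suc k)) \<le> weight a (Suc k) * y (Suc k)"
      by (simp add: y_nonneg abs_mult)
  qed
  then have sm1: "summable (\<lambda>k. (psum_max a (4 * k))\<^sup>2 / real k * y k)"
    by (subst (asm) summable_Suc_iff)

  have sm2: "summable (\<lambda>i. (psum a i)\<^sup>2 * (y i - y (Suc i)))"
  proof (rule summableI_nonneg_bounded)
    show "0 \<le> (psum a i)\<^sup>2 * (y i - y (Suc i))" for i by (simp add: y_antimono)
    fix n
    have "(\<Sum>i<n. (psum a i)\<^sup>2 * (y i - y (Suc i))) \<le>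
        (\<Sum>i<n. ((psum a (Suc i))\<^sup>2 - (psum a i)\<^sup>2) * y (Suc i))"
      by (simp add: y_nonneg del: psum_Suc flip: abel_real)
    also have "\<dots> \<le> (\<Sum>i<n. weight a (Suc i) * y (Suc i))"
      by (intro sum_mono mult_right_mono y_nonneg) (simp add: weight_def del: psum_Suc)
    also have "\<dots> \<le> (\<Sum>k. weight a (Suc k) * y (Suc k))"
      using sm by (intro sum_le_suminf) (auto simp: weight_nonneg y_nonneg)
    finally show "(\<Sum>i<n. (psum a i)\<^sup>2 * (y i - y (Suc i))) \<le> (\<Sum>k. weight a (Suc k) * y (Suc k))" .
  qed
  have R: "R \<longlonglongrightarrow> 0" unfolding R_def[abs_def] using sm2 by (rule transform_tail)

  have scaled: "AE \<omega> in M. (\<lambda>n. psum a n *\<^sub>R Y n \<omega>) \<longlonglongrightarrow> 0" "(\<lambda>n. (psum a n)\<^sup>2 * y n) \<longlonglongrightarrow> 0"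
    using psum_max_mono[of _ _ a] abs_psum_le_psum_max[of _ _ a] sm1
    by (fact scaled_tendsto_AE scaled_tendsto_L2)+
  \<comment> \<open>Defining \<open>Z\<close> pointwise by \<open>lim\<close> gives a measurable
    function on the whole space; its values off the convergence set are irrelevant almost
    surely.\<close>
  define Z where "Z \<omega> = lim (\<lambda>n. S n \<omega>)" for \<omega>
  have Z [measurable]: "Z \<in> borel_measurable M" unfolding Z_def[abs_def] by measurable
  have AE: "AE \<omega> in M. (\<lambda>n. S n \<omega>) \<longlonglongrightarrow> Z \<omega> \<and> (\<lambda>n. U n \<omega>) \<longlonglongrightarrow> Z \<omega>"
    using transform_AE_convergent[OF sm2] scaled(1)
  proof eventually_elim
    case (elim \<omega>)
    from elim(1) obtain l where l: "(\<lambda>n. U n \<omega>) \<longlonglongrightarrow> l" by (auto simp: convergent_def U_def)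
    have "(\<lambda>n. S n \<omega>) \<longlonglongrightarrow> l" using tendsto_add[OF elim(2) l] by (simp add: S)
    with l show ?case by (simp add: Z_def limI)
  qed
  \<comment> \<open>Fatou along \<open>m\<close> applied to \<open>U n - U (m + n)\<close>, whose
    second moments are partial sums of \<open>R n\<close>. This upgrades almost sure convergence of
    \<open>U\<close> to convergence in L2 with rate \<open>R n\<close>.\<close>
  have bound: "(\<lambda>\<omega>. U n \<omega> - Z \<omega>) \<in> L2_space M" "(LINT \<omega>|M. (norm (U n \<omega> - Z \<omega>))\<^sup>2) \<le> R n" for n
  proof -
    have diff: "U n \<omega> - U (m + n) \<omega> = - (\<Sum>i=n..<m + n. psum a i *\<^sub>R D i \<omega>)" for m \<omega>
      using sum.atLeastLessThan_concat[of 0 n "m + n" "\<lambda>i. psum a i *\<^sub>R D i \<omega>"]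
      by (simp add: U_def atLeast0LessThan algebra_simps)
    have le: "(LINT \<omega>|M. (norm (U n \<omega> - U (m + n) \<omega>))\<^sup>2) \<le> R n" for m
    proof -
      have "(LINT \<omega>|M. (norm (U n \<omega> - U (m + n) \<omega>))\<^sup>2) = (\<Sum>i=n..<m + n. (psum a i)\<^sup>2 * (y i - y (Suc i)))"
        by (simp only: diff norm_minus_cancel transform_second_moment)
      also have "\<dots> = (\<Sum>i<m. (psum a (i + n))\<^sup>2 * (y (i + n) - y (Suc (i + n))))"
        using sum.shift_bounds_nat_ivl[of "\<lambda>i. (psum a i)\<^sup>2 * (y i - y (Suc i))" 0 n m]
        by (simp add: atLeast0LessThan)
      also have "\<dots> \<le> R n" unfolding R_def
        using summable_ignore_initial_segment[OF sm2, of n]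
        by (intro sum_le_suminf) (auto intro!: mult_nonneg_nonneg simp: y_antimono)
      finally show ?thesis .
    qed
    have lim: "AE \<omega> in M. (\<lambda>m. U n \<omega> - U (m + n) \<omega>) \<longlonglongrightarrow> U n \<omega> - Z \<omega>"
      using AE by eventually_elim (auto intro!: tendsto_intros LIMSEQ_ignore_initial_segment)
    show "(\<lambda>\<omega>. U n \<omega> - Z \<omega>) \<in> L2_space M" "(LINT \<omega>|M. (norm (U n \<omega> - Z \<omega>))\<^sup>2) \<le> R n"
      by (rule L2_Fatou[OF L2_space_diff[OF UL2 UL2] lim _ le]; measurable)+
  qed
  \<comment> \<open>\<open>Z\<close> is the difference of \<open>U 0\<close> and
    \<open>U 0 - Z\<close>, both square integrable.\<close>
  have ZL2: "Z \<in> L2_space M"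
    using L2_space_diff[OF UL2[of 0] bound(1)[of 0]] by simp
  have le: "(LINT \<omega>|M. (norm (S n \<omega> - Z \<omega>))\<^sup>2) \<le> 2 * ((psum a n)\<^sup>2 * y n) + 2 * R n" for n
  proof -
    have "(LINT \<omega>|M. (norm (S n \<omega> - Z \<omega>))\<^sup>2) \<le>
        (LINT \<omega>|M. 2 * (norm (psum a n *\<^sub>R Y n \<omega>))\<^sup>2 + 2 * (norm (U n \<omega> - Z \<omega>))\<^sup>2)"
    proof (rule integral_mono)
      show "integrable M (\<lambda>\<omega>. (norm (S n \<omega> - Z \<omega>))\<^sup>2)"
        by (rule L2_space_integrable[OF L2_space_diff[OF SL2 ZL2]])
      show "integrable M (\<lambda>\<omega>. 2 * (norm (psum a n *\<^sub>R Y n \<omega>))\<^sup>2 + 2 * (norm (U n \<omega> - Z \<omega>))\<^sup>2)"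
        using L2_space_integrable[OF L2_space_scaleR[OF L2]] L2_space_integrable[OF bound(1)]
        by (intro Bochner_Integration.integrable_add integrable_mult_right) auto
      show "(norm (S n \<omega> - Z \<omega>))\<^sup>2 \<le> 2 * (norm (psum a n *\<^sub>R Y n \<omega>))\<^sup>2 + 2 * (norm (U n \<omega> - Z \<omega>))\<^sup>2" for \<omega>
        using norm_add_sq_le[of "psum a n *\<^sub>R Y n \<omega>" "U n \<omega> - Z \<omega>"] by (simp add: S algebra_simps)
    qed
    also have "\<dots> = 2 * ((psum a n)\<^sup>2 * y n) + 2 * (LINT \<omega>|M. (norm (U n \<omega> - Z \<omega>))\<^sup>2)"
      using L2_space_integrable[OF L2[of n]] L2_space_integrable[OF bound(1)[of n]]
      by (simp add: power_mult_distrib y_def)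
    finally show ?thesis using bound(2)[of n] by linarith
  qed
  have "(\<lambda>n. 2 * ((psum a n)\<^sup>2 * y n) + 2 * R n) \<longlonglongrightarrow> 2 * 0 + 2 * 0"
    by (intro tendsto_intros scaled(2) R)
  then have lim0: "(\<lambda>n. 2 * ((psum a n)\<^sup>2 * y n) + 2 * R n) \<longlonglongrightarrow> 0" by simp
  have "(\<lambda>n. LINT \<omega>|M. (norm (S n \<omega> - Z \<omega>))\<^sup>2) \<longlonglongrightarrow> 0"
    by (rule tendsto_sandwich[OF _ _ tendsto_const lim0]) (use le in auto)
  then have "(\<lambda>n. L2_norm M (\<lambda>\<omega>. S n \<omega> - Z \<omega>)) \<longlonglongrightarrow> 0"
    unfolding L2_norm_def using tendsto_real_sqrt[of _ 0] by simp
  then have "tendsto_L2 M S Z" by (simp add: tendsto_L2_def SL2 ZL2)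
  then show ?thesis using AE unfolding S_def[abs_def] by (intro exI[of _ Z]) auto
qed

end

section \<open>Reduction to a square-integrable reverse martingale\<close>

theorem corollary9:
  fixes M :: "'a measure"
    and F :: "nat \<Rightarrow> 'a measure"
    and X :: "'a \<Rightarrow> 'h::{real_inner, banach, second_countable_topology}"
    and Y :: "nat \<Rightarrow> 'a \<Rightarrow> 'h"
    and a :: "nat \<Rightarrow> real"
  assumes "prob_space M"
    and "\<And>k. k \<ge> 1 \<Longrightarrow> subalgebra M (F k)"
    and "\<And>k. k \<ge> 1 \<Longrightarrow> sets (F (Suc k)) \<subseteq> sets (F k)"
    and "integrable M X"
    and "\<And>k. k \<ge> 1 \<Longrightarrow> has_cond_exp M (F k) X (Y k)"
    and "(\<Sum>j. ennreal \<bar>a (Suc j)\<bar>) = \<infinity>"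
    and "(\<Sum>k. ennreal (weight a (Suc k)) *
            (\<integral>\<^sup>+ \<omega>. ennreal ((norm (Y (Suc k) \<omega>))\<^sup>2) \<partial>M)) < \<infinity>"
  shows "\<exists>Z. tendsto_L2 M (\<lambda>n \<omega>. \<Sum>i=1..n. a i *\<^sub>R Y i \<omega>) Z \<and>
             (AE \<omega> in M. (\<lambda>n. \<Sum>i=1..n. a i *\<^sub>R Y i \<omega>) \<longlonglongrightarrow> Z \<omega>)"
proof -
  let ?y = "\<lambda>k. \<integral>\<^sup>+ \<omega>. ennreal ((norm (Y k \<omega>))\<^sup>2) \<partial>M"
  have psum0: "psum a k = 0" if k: "1 \<le> k" and w: "\<not> 0 < weight a k" for k
  proof -
    have "(psum_max a (4 * k))\<^sup>2 / real k \<le> weight a k" by (simp add: weight_def)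
    with w have "(psum_max a (4 * k))\<^sup>2 / real k \<le> 0" by linarith
    with k have "psum_max a (4 * k) = 0" by (simp add: divide_le_0_iff)
    with abs_psum_le_psum_max[of k "4 * k" a] k show ?thesis by simp
  qed
  \<comment> \<open>The divergence of the series of absolute values enters here: if no weight were
    positive, all partial sums and hence all coefficients would vanish.\<close>
  have ex: "\<exists>k\<ge>1. 0 < weight a k"
  proof (rule ccontr)
    assume "\<not> ?thesis"
    then have *: "psum a k = 0" for k using psum0[of k] by (cases "k = 0") auto
    have "a (Suc j) = 0" for j using *[of "Suc j"] *[of j] by simp
    with assms(6) show False by simp
  qed
  \<comment> \<open>\<open>K\<close> is the first index with positive weight. Below it the partial
    sums, and so the coefficients, are 0; from it on all weights are positive.\<close>
  define K where "K = (LEAST k. 1 \<le> k \<and> 0 < weight a k)"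
  have K: "1 \<le> K" "0 < weight a K" using LeastI_ex[OF ex] by (auto simp: K_def)
  have below: "psum a k = 0" if "k < K" for k
    using not_less_Least[of k "\<lambda>k. 1 \<le> k \<and> 0 < weight a k"] that psum0[of k]
    by (cases "k = 0") (auto simp: K_def)
  \<comment> \<open>A weight that is not positive at \<open>k \<ge> K\<close> makes the partial sums
    vanish up to \<open>4 * k\<close>, hence up to \<open>4 * K\<close>, and then both entries of
    \<open>weight a K\<close> are 0.\<close>
  have above: "0 < weight a k" if k: "K \<le> k" for k
  proof (rule ccontr)
    assume "\<not> 0 < weight a k"
    then have "(psum_max a (4 * k))\<^sup>2 / real k \<le> 0" by (simp add: weight_def)
    then have max0: "psum_max a (4 * k) = 0" using K k by (simp add: divide_le_0_iff)
    have z: "psum a j = 0" if "j \<le> 4 * k" for j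
      using abs_psum_le_psum_max[of j "4 * k" a] that max0 by (cases "j = 0") auto
    have "psum_max a (4 * K) = 0"
      unfolding psum_max_def using z k K by (subst Max_eq_iff) (auto simp: image_iff)
    with K(2) z[of K] z[of "K - 1"] k show False by (simp add: weight_def)
  qed
  \<comment> \<open>A positive weight in a finite sum forces a finite second moment. Below
    \<open>K\<close> the convention that 0 times infinity is 0 leaves infinite second moments
    possible.\<close>
  have fin: "?y k < \<infinity>" if k: "K \<le> k" for k
  proof -
    have "ennreal (weight a k) * ?y k < \<infinity>"
      using ennreal_suminf_lessD[OF assms(7), of "k - 1"] K k by simp
    with above[OF k] show ?thesis by (auto simp: ennreal_mult_less_top)
  qed
  have ce: "integrable M (Y k)" "Y k \<in> borel_measurable (F k)"
    "\<And>A. A \<in> sets (F k) \<Longrightarrow> (LINT x:A|M. Y k x) = (LINT x:A|M. X x)" if "1 \<le> k" for k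
    using assms(5)[OF that] by (auto simp: has_cond_exp_def)
  have L2: "Y k \<in> L2_space M" if k: "K \<le> k" for k
  proof (rule L2_spaceI)
    show m [measurable]: "Y k \<in> borel_measurable M" using ce(1)[of k] k K by simp
    show "integrable M (\<lambda>x. (norm (Y k x))\<^sup>2)"
      using fin[OF k] by (intro integrableI_bounded) auto
  qed

  text \<open>Before \<open>K\<close> the coefficients vanish, whereas \<^term>\<open>Y k\<close> need not be square integrable;
    freezing the sequence there changes no partial sum.\<close>
  define Y' where "Y' k = Y (max k K)" for k
  interpret prob_space M by (rule assms(1))
  \<comment> \<open>The fields are frozen together with the variables. For \<open>k < K\<close>
    consecutive fields and variables coincide; otherwise both integrals equal that of
    \<open>X\<close>, as the sets belong to both fields.\<close>
  interpret R: L2_reverse_martingale M "\<lambda>k. F (max k K)" Y'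
  proof
    fix k
    show "subalgebra M (F (max k K))" using assms(2) K by simp
    show *: "sets (F (max (Suc k) K)) \<subseteq> sets (F (max k K))"
    proof (cases "K \<le> k")
      case True
      with assms(3)[of k] K show ?thesis by (simp add: max_def)
    qed (simp add: max_def)
    show "Y' k \<in> L2_space M" unfolding Y'_def by (rule L2) simp
    show "Y' k \<in> borel_measurable (F (max k K))" unfolding Y'_def using K by (intro ce) simp
    fix A assume "A \<in> sets (F (max (Suc k) K))"
    with * show "(LINT x:A|M. Y' k x) = (LINT x:A|M. Y' (Suc k) x)"
      unfolding Y'_def using K by (subst (1 2) ce(3)) auto
  qed
  have sums: "(\<Sum>i=1..n. a i *\<^sub>R Y i \<omega>) = (\<Sum>i=1..n. a i *\<^sub>R Y' i \<omega>)" for n \<omega>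
  proof (rule sum.cong)
    fix i assume i: "i \<in> {1..n}"
    show "a i *\<^sub>R Y i \<omega> = a i *\<^sub>R Y' i \<omega>"
    proof (cases "K \<le> i")
      case False
      then have "a i = 0" using below[of i] below[of "i - 1"] i by (cases i) auto
      then show ?thesis by simp
    qed (simp add: Y'_def max_def)
  qed simp
  \<comment> \<open>Freezing may change the second moments only below \<open>K\<close>, where the
    weights are 0, so the summability hypothesis carries over.\<close>
  have "ennreal (weight a (Suc k) * R.y (Suc k)) \<le> ennreal (weight a (Suc k)) * ?y (Suc k)" for k
  proof (cases "K \<le> Suc k")
    case True
    have "?y (Suc k) = ennreal (R.y (Suc k))"
      unfolding R.y_def using True
      by (subst nn_integral_eq_integral[OF L2_space_integrable[OF L2]]) (auto simp: Y'_def max_def)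
    then show ?thesis by (simp add: ennreal_mult' weight_nonneg)
  next
    case False
    then have "\<not> 0 < weight a (Suc k)"
      using not_less_Least[of "Suc k" "\<lambda>k. 1 \<le> k \<and> 0 < weight a k"] by (auto simp: K_def)
    then have "weight a (Suc k) = 0" using weight_nonneg[of a "Suc k"] by linarith
    then show ?thesis by simp
  qed
  then have "(\<Sum>k. ennreal (weight a (Suc k) * R.y (Suc k))) \<le> (\<Sum>k. ennreal (weight a (Suc k)) * ?y (Suc k))"
    by (intro suminf_le) auto
  with assms(7) have "(\<Sum>k. ennreal (weight a (Suc k) * R.y (Suc k))) \<noteq> top" by auto
  then have "summable (\<lambda>k. weight a (Suc k) * R.y (Suc k))"
    by (intro summable_suminf_not_top) (simp add: weight_nonneg R.y_nonneg)
  from R.weighted_sum_converges[OF this] show ?thesis by (simp only: sums)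
qed

end
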